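(* For $f\in L^1_{\mathrm{loc}}(\mathbb{R}^n)$ the following statements are equivalent: (i) $f\in \mathrm{BLO}(\mathbb{R}^n)$; (ii) $$\sup_{x\in\mathbb{R}^n,\,t>0}\int_{\mathbb{R}^n}W_t(x-y)\Big[f(y)-\operatorname*{ess\,inf}_{z\in B(x,\sqrt t)}f(z)\Big]_+\,dy<\infty;$$ (iii) $$\sup_{x\in\mathbb{R}^n,\,t>0}\left[\frac1{\vartheta_n}\int_{B(x,\sqrt t)}W_t(x-y)f(y)\,dy-\operatorname*{ess\,inf}_{z\in B(x,\sqrt t)}f(z)\right]<\infty.$$ Moreover, there are constants $0<c_n\le C_n<\infty$, depending only on the dimension $n$, such that $$c_n\|f\|_{\mathrm{BLO}(\mathbb{R}^n)}\le \sup_{x\in\mathbb{R}^n,\,t>0}\int_{\mathbb{R}^n}W_t(x-y)\Big[f(y)-\operatorname*{ess\,inf}_{z\in B(x,\sqrt t)}f(z)\Big]_+\,dy\le C_n\|f\|_{\mathrm{BLO}(\mathbb{R}^n)}$$ and $$e^{-1/4}\|f\|_{\mathrm{BLO}(\mathbb{R}^n)}\le \sup_{x\in\mathbb{R}^n,\,t>0}\left[\frac1{\vartheta_n}\int_{B(x,\sqrt t)}W_t(x-y)f(y)\,dy-\operatorname*{ess\,inf}_{z\in B(x,\sqrt t)}f(z)\right]\le e^{1/4}\|f\|_{\mathrm{BLO}(\mathbb{R}^n)}.$$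
   Context: Functions are real-valued. For $f\in L^1_{\mathrm{loc}}(\mathbb{R}^n)$ put $\|f\|_{\mathrm{BLO}(\mathbb{R}^n)}:=\sup_B\frac1{|B|}\int_B\big[f(x)-\operatorname{ess\,inf}_B f\big]\,dx\in[0,\infty]$, the supremum being over all balls $B\subset\mathbb{R}^n$; $f\in\mathrm{BLO}(\mathbb{R}^n)$ means $\|f\|_{\mathrm{BLO}(\mathbb{R}^n)}<\infty$. If an essential infimum over a ball is $-\infty$, the corresponding quantities are $+\infty$. $B(x,r)$ is the ball of center $x$ and radius $r$; $[a]_+:=\max(a,0)$. The Gaussian heat kernel is $W_t(x-y)=(4\pi t)^{-n/2}\exp(-|x-y|^2/(4t))$, $t>0$, and $\vartheta_n:=\int_{B(0,1)}(4\pi)^{-n/2}e^{-|z|^2/4}\,dz$. *)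

theory Defs
  imports "HOL-Analysis.Analysis" "HOL-Probability.Essential_Supremum"
begin

text \<open>The dimension is \<open>CARD('n)\<close>.\<close>

definition L1_loc :: "(real ^ 'n \<Rightarrow> real) set" where
  "L1_loc = {f. \<forall>K. compact K \<longrightarrow> f absolutely_integrable_on K}"

text \<open>For measurable \<open>f\<close> the value is \<open>-\<infinity>\<close> exactly when \<open>f\<close> is not essentially bounded below
  on \<open>B\<close>. It is never \<open>\<infinity>\<close> for \<open>B\<close> of positive measure, since \<open>f\<close> is real-valued.\<close>

definition ess_inf :: "(real ^ 'n) set \<Rightarrow> (real ^ 'n \<Rightarrow> real) \<Rightarrow> ereal" where
  "ess_inf B f = - esssup (lebesgue_on B) (\<lambda>x. - ereal (f x))"

lemma ess_inf_eq_AE: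
  assumes "f \<in> borel_measurable (lebesgue_on B)"
  shows "ess_inf B f = Sup {c. AE x in lebesgue_on B. c \<le> ereal (f x)}"
proof -
  have "(\<lambda>x. - ereal (f x)) \<in> borel_measurable (lebesgue_on B)"
    using assms by measurable
  then have "ess_inf B f = - Inf {c. AE x in lebesgue_on B. - ereal (f x) \<le> c}"
    unfolding ess_inf_def by (subst esssup_eq_AE) auto
  also have "{c. AE x in lebesgue_on B. - ereal (f x) \<le> c}
      = uminus ` {c. AE x in lebesgue_on B. c \<le> ereal (f x)}" (is "?L = uminus ` ?R")
  proof -
    have *: "c \<in> ?L \<longleftrightarrow> - c \<in> ?R" for c
      by (simp only: mem_Collect_eq ereal_uminus_le_reorder)
    show ?thesis
    proof (intro set_eqI iffI)
      fix c assume "c \<in> ?L"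
      then show "c \<in> uminus ` ?R"
        using * by (intro image_eqI[of _ _ "- c"]) simp_all
    next
      fix c assume "c \<in> uminus ` ?R"
      then obtain d where "c = - d" "d \<in> ?R" by blast
      then show "c \<in> ?L"
        using *[of c] by (simp only: ereal_uminus_uminus)
    qed
  qed
  finally show ?thesis
    by (simp add: ereal_Inf_uminus_image_eq)
qed

text \<open>Mean over \<open>B\<close> of \<open>f\<close> minus its essential infimum, with the convention that it is \<open>\<infinity>\<close>
  when the essential infimum is \<open>-\<infinity>\<close>.\<close>

definition lower_osc :: "(real ^ 'n) set \<Rightarrow> (real ^ 'n \<Rightarrow> real) \<Rightarrow> ereal" where
  "lower_osc B f =
     (if ess_inf B f = - \<infinity> then \<infinity>
      else ereal ((LINT x:B|lebesgue. f x - real_of_ereal (ess_inf B f)) / measure lebesgue B))"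

definition BLO_norm :: "(real ^ 'n \<Rightarrow> real) \<Rightarrow> ereal" where
  "BLO_norm f = (SUP (x, r) \<in> UNIV \<times> {0<..}. lower_osc (ball x r) f)"

definition BLO :: "(real ^ 'n \<Rightarrow> real) set" where
  "BLO = {f \<in> L1_loc. BLO_norm f < \<infinity>}"

definition heat_kernel :: "real \<Rightarrow> real ^ 'n \<Rightarrow> real" where
  "heat_kernel t z = (4 * pi * t) powr (- real CARD('n) / 2) * exp (- (norm z)\<^sup>2 / (4 * t))"

definition vartheta :: "'n::finite itself \<Rightarrow> real" where
  "vartheta _ = (LINT z:ball (0 :: real ^ 'n) 1|lebesgue.
     (4 * pi) powr (- real CARD('n) / 2) * exp (- (norm z)\<^sup>2 / 4))"

text \<open>If the essential infimum is \<open>-\<infinity>\<close>, then \<open>ereal a - (-\<infinity>) = \<infinity>\<close> and the kernel is positive, so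
  the two expressions below are \<open>\<infinity>\<close>, as they should be. The first integral may be infinite for
  other reasons too, and is therefore a nonnegative integral.\<close>

definition heat_pos_sup :: "(real ^ 'n \<Rightarrow> real) \<Rightarrow> ereal" where
  "heat_pos_sup f = (SUP (x, t) \<in> UNIV \<times> {0<..}.
     enn2ereal (\<integral>\<^sup>+ y. ennreal (heat_kernel t (x - y)) *
       e2ennreal (max (ereal (f y) - ess_inf (ball x (sqrt t)) f) 0) \<partial>lebesgue))"

definition heat_local_sup :: "(real ^ 'n \<Rightarrow> real) \<Rightarrow> ereal" where
  "heat_local_sup f = (SUP (x, t) \<in> UNIV \<times> {0<..}.
     ereal (1 / vartheta TYPE('n) *
       (LINT y:ball x (sqrt t)|lebesgue. heat_kernel t (x - y) * f y))
     - ess_inf (ball x (sqrt t)) f)"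

end

(* With m_B the essential infimum of f over B = B(x, sqrt t), all three functionals compare weighted
   integrals of f - m_B, which is nonnegative almost everywhere on B. On B the kernel W_t varies by
   a factor of at most e^(1/4) and vartheta_n is its total mass there, so the normalised weight in (iii)
   is within e^(1/4) of 1/|B|. For the upper bound in (ii), the part of the integral with
   k sqrt t <= |x - y| < (k+1) sqrt t is controlled by the ball B_k = B(x, (k+1) sqrt t): since
   m_(B_k) <= m_B, the positive part of f - m_B is at most that of f - m_(B_k), whose integral over B_k
   is at most |B_k| times the BLO norm. The Gaussian factor e^(-k^2/4) makes the sum over k converge,
   and no telescoping between the balls is needed. *)

theory Submission
  imports Defs "HOL-Real_Asymp.Real_Asymp"
begin

section \<open>Balls and locally integrable functions\<close>

lemma measure_ball_pos: "0 < r \<Longrightarrow> 0 < measure lebesgue (ball x r)"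
  for x :: "'a::euclidean_space"
  by (simp add: content_ball_pos)

lemma measure_ball_scale:
  fixes x :: "real ^ 'n"
  assumes "0 \<le> r"
  shows "measure lebesgue (ball x r) = r ^ CARD('n) * measure lebesgue (ball (0 :: real ^ 'n) 1)"
  using assms by (simp add: content_ball mult.commute)

lemma L1_loc_set_integrable_ball:
  assumes "f \<in> L1_loc"
  shows "set_integrable lebesgue (ball x r) f"
proof -
  have "set_integrable lebesgue (cball x r) f"
    using assms by (simp add: L1_loc_def)
  then show ?thesis
    by (rule set_integrable_subset) (auto simp: ball_subset_cball)
qed

text \<open>Local integrability gives measurability of each cut-off of \<open>f\<close> to a ball
  about 0, and at every point these cut-offs eventually equal \<open>f\<close>.\<close>

lemma L1_loc_measurable:
  assumes "f \<in> L1_loc"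
  shows "f \<in> borel_measurable lebesgue"
proof (rule borel_measurable_LIMSEQ_real)
  show "(\<lambda>y. indicator (ball 0 (real k)) y *\<^sub>R f y) \<in> borel_measurable lebesgue" for k
    using L1_loc_set_integrable_ball[OF assms] by (auto simp: set_integrable_def)
  show "(\<lambda>k. indicator (ball 0 (real k)) y *\<^sub>R f y) \<longlonglongrightarrow> f y" for y
  proof (rule tendsto_eventually)
    obtain k0 where "norm y < real k0" using reals_Archimedean2 by blast
    then show "\<forall>\<^sub>F k in sequentially. indicator (ball 0 (real k)) y *\<^sub>R f y = f y"
      by (intro eventually_sequentiallyI[of k0]) (auto simp: indicator_def)
  qed
qed

section \<open>Essential infima over balls and the mean lower oscillation\<close>

lemma AE_ess_inf_le:
  assumes "B \<in> sets lebesgue"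
  shows "AE y in lebesgue. y \<in> B \<longrightarrow> ess_inf B f \<le> ereal (f y)"
proof -
  have "AE y in lebesgue_on B. - ereal (f y) \<le> esssup (lebesgue_on B) (\<lambda>x. - ereal (f x))"
    by (rule esssup_AE)
  then have "AE y in lebesgue_on B. ess_inf B f \<le> ereal (f y)"
    by (auto simp: ess_inf_def ereal_uminus_le_reorder elim!: eventually_mono)
  then show ?thesis
    using assms by (simp add: AE_restrict_space_iff)
qed

text \<open>As \<open>f\<close> is real-valued, an infinite essential infimum would leave almost no
  points in the ball, which has positive measure.\<close>

lemma ess_inf_ball_less_PInf:
  assumes "0 < r"
  shows "ess_inf (ball x r) f < \<infinity>"
proof (rule ccontr)
  assume "\<not> ess_inf (ball x r) f < \<infinity>"
  then have "ess_inf (ball x r) f = \<infinity>" by simp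
  then have "AE y in lebesgue. y \<notin> ball x r"
    using AE_ess_inf_le[of "ball x r" f] by simp
  then have "emeasure lebesgue (ball x r) = 0"
    by (subst (asm) AE_iff_measurable[of "ball x r"]) auto
  then show False
    using measure_ball_pos[OF assms, of x] unfolding measure_def by simp
qed

text \<open>The lower bound on \<open>B\<close> also holds almost everywhere on \<open>A\<close>, so
  it competes in the supremum that characterises \<open>ess_inf A f\<close>.\<close>

lemma ess_inf_antimono:
  assumes f: "f \<in> borel_measurable lebesgue" and AB: "A \<subseteq> B"
    and A: "A \<in> sets lebesgue" and B: "B \<in> sets lebesgue"
  shows "ess_inf B f \<le> ess_inf A f"
proof -
  have "AE y in lebesgue. y \<in> A \<longrightarrow> ess_inf B f \<le> ereal (f y)"
    using AE_ess_inf_le[OF B, of f] AB by (auto elim!: eventually_mono)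
  then have "AE y in lebesgue_on A. ess_inf B f \<le> ereal (f y)"
    using A by (simp add: AE_restrict_space_iff)
  moreover have "f \<in> borel_measurable (lebesgue_on A)"
    using f by (rule measurable_restrict_space1)
  ultimately show ?thesis
    by (subst ess_inf_eq_AE[of _ A]) (auto intro: Sup_upper)
qed

lemma ess_inf_ball_cases:
  assumes "0 < r"
  obtains "ess_inf (ball x r) f = - \<infinity>" | m where "ess_inf (ball x r) f = ereal m"
  using ess_inf_ball_less_PInf[OF assms, of x f] by (cases "ess_inf (ball x r) f") auto

lemma AE_ess_inf_ball_le:
  assumes "ess_inf (ball x r) f = ereal m"
  shows "AE y in lebesgue. y \<in> ball x r \<longrightarrow> m \<le> f y"
  using AE_ess_inf_le[of "ball x r" f] assms by simp

lemma set_integrable_const_ball: "set_integrable lebesgue (ball x r) (\<lambda>_. c :: real)"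
  for x :: "'a::euclidean_space"
  unfolding set_integrable_def
  by (intro integrable_scaleR_left integrable_real_indicator) (use emeasure_lborel_ball_finite[of x r] in auto)

lemma set_integral_one_ball: "(LINT y:ball x r|lebesgue. (1 :: real)) = measure lebesgue (ball x r)"
  for x :: "'a::euclidean_space"
  by (simp add: set_lebesgue_integral_def)

lemma set_integrable_diff_const_ball:
  assumes "f \<in> L1_loc"
  shows "set_integrable lebesgue (ball x r) (\<lambda>y. f y - c)"
  using L1_loc_set_integrable_ball[OF assms] set_integrable_const_ball by (rule set_integral_diff)

lemma lower_osc_finite:
  assumes "ess_inf B f = ereal m"
  shows "lower_osc B f = ereal ((LINT y:B|lebesgue. f y - m) / measure lebesgue B)"
  using assms by (simp add: lower_osc_def)

lemma set_integral_diff_ess_inf_nonneg: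
  assumes "ess_inf (ball x r) f = ereal m"
  shows "0 \<le> (LINT y:ball x r|lebesgue. f y - m)"
  unfolding set_lebesgue_integral_def using AE_ess_inf_ball_le[OF assms]
  by (intro integral_nonneg_AE) (auto simp: indicator_def elim!: eventually_mono)

lemma lower_osc_le_BLO_norm: "0 < r \<Longrightarrow> lower_osc (ball x r) f \<le> BLO_norm f"
  unfolding BLO_norm_def by (rule SUP_upper2[of "(x, r)"]) auto

text \<open>A single ball suffices, since the norm is a supremum; this excludes the value
  \<open>-\<infinity>\<close> in later case splits.\<close>

lemma BLO_norm_nonneg: "0 \<le> BLO_norm f"
proof -
  have "0 \<le> lower_osc (ball 0 1) f"
  proof (rule ess_inf_ball_cases[of 1 0 f])
    fix m assume "ess_inf (ball 0 1) f = ereal m"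
    then show ?thesis
      using set_integral_diff_ess_inf_nonneg[of 0 1 f m] by (simp add: lower_osc_finite)
  qed (auto simp: lower_osc_def)
  also have "\<dots> \<le> BLO_norm f" by (rule lower_osc_le_BLO_norm) simp
  finally show ?thesis .
qed

text \<open>Bridge between the nonnegative integral in (ii) and the Lebesgue integral in
  \<open>lower_osc\<close>: \<open>ennreal\<close> cuts off negative values, which
  \<open>f y - m\<close> takes only on a null subset of the ball.\<close>

lemma nn_integral_diff_ess_inf:
  assumes "f \<in> L1_loc" and m: "ess_inf (ball x r) f = ereal m"
  shows "(\<integral>\<^sup>+ y. ennreal (f y - m) * indicator (ball x r) y \<partial>lebesgue)
    = ennreal (LINT y:ball x r|lebesgue. f y - m)"
proof -
  have "(\<integral>\<^sup>+ y. ennreal (f y - m) * indicator (ball x r) y \<partial>lebesgue)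
    = (\<integral>\<^sup>+ y. ennreal (indicator (ball x r) y *\<^sub>R (f y - m)) \<partial>lebesgue)"
    by (intro nn_integral_cong) (auto simp: indicator_def)
  also have "\<dots> = ennreal (LINT y:ball x r|lebesgue. f y - m)"
    unfolding set_lebesgue_integral_def
    using set_integrable_diff_const_ball[OF assms(1), of x r m] AE_ess_inf_ball_le[OF m]
    by (intro nn_integral_eq_integral)
       (auto simp: set_integrable_def indicator_def elim!: eventually_mono)
  finally show ?thesis .
qed

section \<open>Size, scaling and local mass of the Gaussian kernel\<close>

definition heat_peak :: "'n::finite itself \<Rightarrow> real \<Rightarrow> real" where
  "heat_peak _ t = (4 * pi * t) powr (- real CARD('n) / 2)"

lemma heat_peak_pos: "0 < t \<Longrightarrow> 0 < heat_peak TYPE('n::finite) t"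
  by (simp add: heat_peak_def)

text \<open>Splits off the maximum of the kernel, attained at the origin, which carries the scaling
  in \<open>t\<close>.\<close>

lemma heat_kernel_eq: "heat_kernel t z = heat_peak TYPE('n) t * exp (- (norm z)\<^sup>2 / (4 * t))"
  for z :: "real ^ 'n"
  by (simp add: heat_kernel_def heat_peak_def)

lemma heat_kernel_pos: "0 < t \<Longrightarrow> 0 < heat_kernel t z" for z :: "real ^ 'n"
  by (simp add: heat_kernel_eq heat_peak_pos)

lemma heat_kernel_measurable [measurable]:
  "(\<lambda>y. heat_kernel t (x - y)) \<in> borel_measurable borel" for x :: "real ^ 'n"
  unfolding heat_kernel_def by measurable

lemma heat_kernel_le_peak: "0 < t \<Longrightarrow> heat_kernel t z \<le> heat_peak TYPE('n) t"
  for z :: "real ^ 'n"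
  using heat_peak_pos[of t, where 'n='n] by (simp add: heat_kernel_eq)

text \<open>Here \<open>s\<close> measures distance in units of \<open>sqrt t\<close>; with
  \<open>s = k\<close> this is the decay on the k-th shell.\<close>

lemma heat_kernel_le:
  fixes z :: "real ^ 'n"
  assumes "0 < t" "sqrt t * s \<le> norm z" "0 \<le> s"
  shows "heat_kernel t z \<le> heat_peak TYPE('n) t * exp (- s\<^sup>2 / 4)"
proof -
  have "(sqrt t * s)\<^sup>2 \<le> (norm z)\<^sup>2"
    using assms by (intro power_mono) auto
  then have "s\<^sup>2 / 4 \<le> (norm z)\<^sup>2 / (4 * t)"
    using assms by (simp add: field_simps power_mult_distrib)
  then show ?thesis
    using heat_peak_pos[OF assms(1), where 'n='n] by (simp add: heat_kernel_eq)
qed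

text \<open>Source of every factor e^(1/4): the Gaussian exponent is at least -1/4 as long as |z|
  does not exceed \<open>sqrt t\<close>.\<close>

lemma heat_kernel_ge:
  fixes z :: "real ^ 'n"
  assumes "0 < t" "norm z \<le> sqrt t"
  shows "heat_peak TYPE('n) t * exp (- (1 / 4)) \<le> heat_kernel t z"
proof -
  have "(norm z)\<^sup>2 \<le> (sqrt t)\<^sup>2"
    using assms by (intro power_mono) auto
  then have "(norm z)\<^sup>2 / (4 * t) \<le> 1 / 4"
    using assms by (simp add: field_simps)
  then show ?thesis
    using heat_peak_pos[OF assms(1), where 'n='n] by (simp add: heat_kernel_eq)
qed

lemma heat_peak_scale:
  assumes "0 < t"
  shows "heat_peak TYPE('n) t * sqrt t ^ CARD('n) = heat_peak TYPE('n::finite) 1"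
proof -
  have "sqrt t ^ CARD('n) = t powr (real CARD('n) / 2)"
    using assms by (simp add: powr_half_sqrt[symmetric] powr_powr powr_realpow[symmetric])
  moreover have "t powr (- real CARD('n) / 2) * t powr (real CARD('n) / 2) = 1"
    using assms by (simp add: powr_add[symmetric])
  ultimately show ?thesis
    using assms by (simp add: heat_peak_def powr_mult)
qed

text \<open>The peak scales like t^(-n/2) and the volume like t^(n/2), so \<open>t\<close> cancels.
  This is why the constants in (ii) depend on the dimension only.\<close>

lemma heat_peak_measure_ball:
  fixes x :: "real ^ 'n"
  assumes "0 < t" "0 \<le> s"
  shows "heat_peak TYPE('n) t * measure lebesgue (ball x (sqrt t * s))
    = heat_peak TYPE('n) 1 * measure lebesgue (ball (0 :: real ^ 'n) 1) * s ^ CARD('n)"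
  using assms
  by (simp add: measure_ball_scale[of "sqrt t * s" x] power_mult_distrib heat_peak_scale[symmetric, of t]
      del: measure_completion)

text \<open>The substitution y = x + sqrt t z has Jacobian (sqrt t)^n, which
  \<open>heat_peak_scale\<close> absorbs, and turns the ball into the unit ball.\<close>

lemma heat_kernel_ball_integral:
  fixes x :: "real ^ 'n"
  assumes t: "0 < t"
  shows "(LINT y:ball x (sqrt t)|lebesgue. heat_kernel t (x - y)) = vartheta TYPE('n)"
proof -
  let ?F = "\<lambda>y. indicator (ball x (sqrt t)) y *\<^sub>R heat_kernel t (x - y)"
  let ?G = "\<lambda>z. indicator (ball 0 1) z *\<^sub>R heat_kernel 1 (z :: real ^ 'n)"
  let ?T = "\<lambda>z. x + sqrt t *\<^sub>R z"
  have [measurable]: "?F \<in> borel_measurable borel"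
    by (intro borel_measurable_scaleR borel_measurable_indicator heat_kernel_measurable) auto
  have [measurable]: "?T \<in> borel_measurable borel"
    by (intro borel_measurable_continuous_onI continuous_intros)
  have [measurable]: "?G \<in> borel_measurable borel"
    unfolding heat_kernel_def
    by (intro borel_measurable_scaleR borel_measurable_indicator) (measurable, auto)
  have FT: "sqrt t ^ CARD('n) * ?F (?T z) = ?G z" for z
  proof -
    have "?T z \<in> ball x (sqrt t) \<longleftrightarrow> z \<in> ball 0 1"
      using t by (simp add: dist_norm)
    moreover have "sqrt t ^ CARD('n) * heat_kernel t (x - ?T z) = heat_kernel 1 z"
      using t heat_peak_scale[OF t, where 'n='n]
      by (simp add: heat_kernel_eq power_mult_distrib mult.assoc[symmetric] mult.commute)
    ultimately show ?thesis by (simp add: indicator_def)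
  qed
  \<comment> \<open>The change of variables is carried out for \<open>lborel\<close>; both
    integrands are Borel, so passing from the completion and back preserves the integrals.\<close>
  have "(LINT y:ball x (sqrt t)|lebesgue. heat_kernel t (x - y)) = integral\<^sup>L lborel ?F"
    unfolding set_lebesgue_integral_def by (rule integral_completion) measurable
  also have "\<dots> = integral\<^sup>L (density (distr lborel borel ?T)
      (\<lambda>_. ennreal (\<bar>sqrt t\<bar> ^ DIM(real ^ 'n)))) ?F"
    using t by (subst lborel_affine[of "sqrt t" x]) (simp_all add: ennreal_power)
  also have "\<dots> = (\<integral>y. sqrt t ^ CARD('n) * ?F y \<partial>distr lborel borel ?T)"
  proof (subst integral_density)
    show "?F \<in> borel_measurable (distr lborel borel ?T)" by measurable
  qed (use t in auto)
  also have "\<dots> = (\<integral>z. sqrt t ^ CARD('n) * ?F (?T z) \<partial>lborel)"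
    by (rule integral_distr) measurable
  also have "\<dots> = integral\<^sup>L lborel ?G"
    by (simp only: FT)
  also have "\<dots> = integral\<^sup>L lebesgue ?G"
    by (rule integral_completion[symmetric]) measurable
  also have "\<dots> = vartheta TYPE('n)"
    by (simp only: vartheta_def set_lebesgue_integral_def heat_kernel_def mult_1_right)
  finally show ?thesis .
qed

section \<open>Kernel-weighted integrals over a ball and the local functional (iii)\<close>

lemma set_integrable_heat_kernel_mult:
  fixes x :: "real ^ 'n" and g :: "real ^ 'n \<Rightarrow> real"
  assumes "0 < t" "set_integrable lebesgue (ball x r) g"
  shows "set_integrable lebesgue (ball x r) (\<lambda>y. heat_kernel t (x - y) * g y)"
proof (rule set_integrable_bound)
  show "set_integrable lebesgue (ball x r) (\<lambda>y. heat_peak TYPE('n) t * g y)"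
    using assms(2) by simp
  have [measurable]: "(\<lambda>y. indicator (ball x r) y *\<^sub>R g y) \<in> borel_measurable lebesgue"
    using assms(2) by (auto simp: set_integrable_def)
  have [measurable]: "(\<lambda>y. heat_kernel t (x - y)) \<in> borel_measurable lebesgue"
    by (rule measurable_completion) simp
  \<comment> \<open>Only the cut-off of \<open>g\<close> to the ball is known to be measurable, so
    the indicator stays attached to \<open>g\<close>.\<close>
  have "(\<lambda>y. heat_kernel t (x - y) * (indicator (ball x r) y *\<^sub>R g y)) \<in> borel_measurable lebesgue"
    by measurable
  then show "set_borel_measurable lebesgue (ball x r) (\<lambda>y. heat_kernel t (x - y) * g y)"
    by (simp add: set_borel_measurable_def mult_ac)
  show "AE y in lebesgue. y \<in> ball x r \<longrightarrow>
      norm (heat_kernel t (x - y) * g y) \<le> norm (heat_peak TYPE('n) t * g y)"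
    using heat_kernel_le_peak[OF assms(1), where 'n='n] heat_kernel_pos[OF assms(1), where 'n='n]
    by (intro AE_I2) (auto simp: abs_mult abs_of_pos heat_peak_pos[OF assms(1)]
        intro!: mult_right_mono)
qed

lemma heat_kernel_ball_integral_bounds:
  fixes x :: "real ^ 'n" and g :: "real ^ 'n \<Rightarrow> real"
  assumes t: "0 < t" and g: "set_integrable lebesgue (ball x (sqrt t)) g"
    and nn: "AE y in lebesgue. y \<in> ball x (sqrt t) \<longrightarrow> 0 \<le> g y"
  shows "heat_peak TYPE('n) t * exp (- (1 / 4)) * (LINT y:ball x (sqrt t)|lebesgue. g y)
      \<le> (LINT y:ball x (sqrt t)|lebesgue. heat_kernel t (x - y) * g y)" (is ?lower)
    and "(LINT y:ball x (sqrt t)|lebesgue. heat_kernel t (x - y) * g y)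
      \<le> heat_peak TYPE('n) t * (LINT y:ball x (sqrt t)|lebesgue. g y)" (is ?upper)
proof -
  note int = set_integrable_heat_kernel_mult[OF t g]
  show ?lower
    unfolding set_integral_mult_right[symmetric]
  proof (rule set_integral_mono_AE)
    show "AE y\<in>ball x (sqrt t) in lebesgue.
        heat_peak TYPE('n) t * exp (- (1 / 4)) * g y \<le> heat_kernel t (x - y) * g y"
      using nn heat_kernel_ge[OF t, where 'n='n]
      by (auto simp: dist_norm intro!: mult_right_mono elim!: eventually_mono)
  qed (use g int in auto)
  show ?upper
    unfolding set_integral_mult_right[symmetric]
  proof (rule set_integral_mono_AE)
    show "AE y\<in>ball x (sqrt t) in lebesgue.
        heat_kernel t (x - y) * g y \<le> heat_peak TYPE('n) t * g y"
      using nn heat_kernel_le_peak[OF t, where 'n='n]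
      by (auto intro!: mult_right_mono elim!: eventually_mono)
  qed (use g int in auto)
qed

text \<open>The preceding estimates for the constant function 1, whose weighted integral is
  \<open>vartheta\<close> for every \<open>t\<close>.\<close>

lemma vartheta_bounds:
  fixes x :: "real ^ 'n"
  assumes t: "0 < t"
  shows "heat_peak TYPE('n) t * exp (- (1 / 4)) * measure lebesgue (ball x (sqrt t)) \<le> vartheta TYPE('n)"
    and "vartheta TYPE('n) \<le> heat_peak TYPE('n) t * measure lebesgue (ball x (sqrt t))"
  using heat_kernel_ball_integral_bounds[OF t set_integrable_const_ball, of x 1]
  by (simp_all add: heat_kernel_ball_integral[OF t] set_integral_one_ball)

lemma vartheta_pos: "0 < vartheta TYPE('n::finite)"
  using vartheta_bounds(1)[of 1 "0 :: real ^ 'n"] heat_peak_pos[of 1, where 'n='n]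
    measure_ball_pos[of 1 "0 :: real ^ 'n"]
  by (smt (verit) exp_gt_zero mult_pos_pos real_sqrt_one)

text \<open>The integral of f - m and the normalisation \<open>vartheta\<close> are each known up to
  a factor e^(1/4), but the losses do not multiply: each bound for the quotient pairs the sharp peak
  bound of one with the e^(-1/4) bound of the other, and the peak cancels.\<close>

lemma heat_local_term_bounds:
  fixes x :: "real ^ 'n"
  assumes f: "f \<in> L1_loc" and t: "0 < t"
  defines "L \<equiv> ereal (1 / vartheta TYPE('n) * (LINT y:ball x (sqrt t)|lebesgue. heat_kernel t (x - y) * f y))
     - ess_inf (ball x (sqrt t)) f"
  shows "ereal (exp (- (1 / 4))) * lower_osc (ball x (sqrt t)) f \<le> L" (is ?lower)
    and "L \<le> ereal (exp (1 / 4)) * lower_osc (ball x (sqrt t)) f" (is ?upper)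
proof -
  let ?B = "ball x (sqrt t)"
  let ?V = "vartheta TYPE('n)" and ?M = "measure lebesgue ?B" and ?a = "heat_peak TYPE('n) t"
  have "?lower \<and> ?upper"
  proof (rule ess_inf_ball_cases[of "sqrt t" x f])
    show "0 < sqrt t" using t by simp
  next
    \<comment> \<open>All three expressions are then infinite.\<close>
    assume "ess_inf ?B f = - \<infinity>"
    then show ?thesis by (simp add: L_def lower_osc_def)
  next
    fix m assume m: "ess_inf ?B f = ereal m"
    let ?I = "LINT y:?B|lebesgue. f y - m"
    let ?J = "LINT y:?B|lebesgue. heat_kernel t (x - y) * (f y - m)"
    have I: "0 \<le> ?I" by (rule set_integral_diff_ess_inf_nonneg[OF m])
    have M: "0 < ?M" using t by (intro measure_ball_pos) simp
    have int: "set_integrable lebesgue ?B (\<lambda>y. heat_kernel t (x - y) * f y)"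
      "set_integrable lebesgue ?B (\<lambda>y. heat_kernel t (x - y) * m)"
      using set_integrable_heat_kernel_mult[OF t] L1_loc_set_integrable_ball[OF f]
        set_integrable_const_ball by blast+
    \<comment> \<open>Since \<open>?V\<close> is the kernel's mass on the ball, division by it lets
      the constant \<open>m\<close> be subtracted under the integral.\<close>
    have "?J = (LINT y:?B|lebesgue. heat_kernel t (x - y) * f y) - ?V * m"
      using set_integral_diff(2)[OF int] heat_kernel_ball_integral[OF t, of x]
      by (simp add: right_diff_distrib)
    then have L: "L = ereal (?J / ?V)"
      using vartheta_pos[where 'n='n] m by (simp add: L_def diff_divide_distrib)
    have J: "?a * exp (- (1 / 4)) * ?I \<le> ?J" "?J \<le> ?a * ?I"
      using heat_kernel_ball_integral_bounds[OF t set_integrable_diff_const_ball[OF f], of x m]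
        AE_ess_inf_ball_le[OF m] by auto
    note V = vartheta_bounds[OF t, of x] and Vpos = vartheta_pos[where 'n='n]
    have "exp (- (1 / 4)) * ?I * ?V \<le> exp (- (1 / 4)) * ?I * (?a * ?M)"
      using V I by (intro mult_left_mono) auto
    also have "\<dots> \<le> ?J * ?M"
      using mult_right_mono[OF J(1), of ?M] M by (simp add: mult_ac)
    finally have "exp (- (1 / 4)) * (?I / ?M) \<le> ?J / ?V"
      using M Vpos by (simp add: field_simps del: measure_completion)
    \<comment> \<open>This factor 1 is inserted so that the lower bound for \<open>?V\<close>
      appears on the right.\<close>
    moreover have "exp (1 / 4) * exp (- (1 / 4)) = (1 :: real)"
      by (simp add: exp_add[symmetric])
    then have "?a * ?I * ?M = exp (1 / 4) * exp (- (1 / 4)) * (?a * ?I * ?M)"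
      by (simp only: mult_1)
    then have "?J * ?M \<le> exp (1 / 4) * ?I * (?a * exp (- (1 / 4)) * ?M)"
      using mult_right_mono[OF J(2), of ?M] M by (simp only: mult_ac less_imp_le)
    then have "?J * ?M \<le> exp (1 / 4) * ?I * ?V"
      using mult_left_mono[OF V(1), of "exp (1 / 4) * ?I"] I
      by (meson exp_ge_zero mult_nonneg_nonneg order_trans)
    then have "?J / ?V \<le> exp (1 / 4) * (?I / ?M)"
      using M Vpos by (simp add: field_simps del: measure_completion)
    ultimately show ?thesis
      by (simp add: L lower_osc_finite[OF m])
  qed
  then show ?lower ?upper by auto
qed

text \<open>A nonnegative real factor moves inside a supremum over a nonempty family, so lower
  bounds can be checked ball by ball.\<close>

lemma mult_BLO_norm_le:
  assumes "0 \<le> c" and le: "\<And>x r. 0 < r \<Longrightarrow> ereal c * lower_osc (ball x r) f \<le> H"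
  shows "ereal c * BLO_norm f \<le> H"
proof -
  have "ereal c * BLO_norm f
      = (SUP p\<in>UNIV \<times> {0<..}. ereal c * (case p of (x, r) \<Rightarrow> lower_osc (ball x r) f))"
    unfolding BLO_norm_def using assms(1) by (intro Sup_ereal_mult_left') (auto intro: exI[of _ 1])
  also have "\<dots> \<le> H" using le by (auto intro!: SUP_least)
  finally show ?thesis .
qed

lemma heat_local_sup_bounds:
  assumes f: "f \<in> L1_loc"
  shows "ereal (exp (- (1 / 4))) * BLO_norm f \<le> heat_local_sup f"
    and "heat_local_sup f \<le> ereal (exp (1 / 4)) * BLO_norm f"
proof -
  show "ereal (exp (- (1 / 4))) * BLO_norm f \<le> heat_local_sup f"
  proof (rule mult_BLO_norm_le)
    \<comment> \<open>The ball of radius \<open>r\<close> is reached at time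
      \<open>r\<^sup>2\<close>.\<close>
    fix x and r :: real assume r: "0 < r"
    then show "ereal (exp (- (1 / 4))) * lower_osc (ball x r) f \<le> heat_local_sup f"
      unfolding heat_local_sup_def
      using heat_local_term_bounds(1)[OF f, of "r\<^sup>2" x]
      by (intro SUP_upper2[of "(x, r\<^sup>2)"]) auto
  qed simp
  show "heat_local_sup f \<le> ereal (exp (1 / 4)) * BLO_norm f"
    unfolding heat_local_sup_def
  proof (intro SUP_least, clarsimp simp del: ereal_minus_le)
    fix x and t :: real assume t: "0 < t"
    have "ereal (exp (1 / 4)) * lower_osc (ball x (sqrt t)) f \<le> ereal (exp (1 / 4)) * BLO_norm f"
      using t by (intro ereal_mult_left_mono lower_osc_le_BLO_norm) auto
    then show "ereal ((LINT y:ball x (sqrt t)|lebesgue. heat_kernel t (x - y) * f y) / vartheta TYPE('a))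
        - ess_inf (ball x (sqrt t)) f \<le> ereal (exp (1 / 4)) * BLO_norm f"
      using heat_local_term_bounds(2)[OF f t, of x] by auto
  qed
qed

section \<open>The positive-part functional (ii)\<close>

lemma enn2ereal_le_ereal_iff: "0 \<le> c \<Longrightarrow> enn2ereal x \<le> ereal c \<longleftrightarrow> x \<le> ennreal c"
  by (metis enn2ereal_ennreal less_eq_ennreal.rep_eq)

lemma ereal_le_enn2ereal_iff: "0 \<le> c \<Longrightarrow> ereal c \<le> enn2ereal x \<longleftrightarrow> ennreal c \<le> x"
  by (metis enn2ereal_ennreal less_eq_ennreal.rep_eq)

text \<open>Discard the integral outside the ball; inside, the kernel is at least e^(-1/4) times its
  peak, and peak times volume is a dimensional constant.\<close>

lemma heat_pos_term_lower:
  fixes x :: "real ^ 'n"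
  assumes f: "f \<in> L1_loc" and t: "0 < t"
  shows "ereal (heat_peak TYPE('n) 1 * measure lebesgue (ball (0 :: real ^ 'n) 1) * exp (- (1 / 4)))
      * lower_osc (ball x (sqrt t)) f
    \<le> enn2ereal (\<integral>\<^sup>+ y. ennreal (heat_kernel t (x - y)) *
       e2ennreal (max (ereal (f y) - ess_inf (ball x (sqrt t)) f) 0) \<partial>lebesgue)"
    (is "?c * _ \<le> enn2ereal ?N")
proof (rule ess_inf_ball_cases[of "sqrt t" x f])
  show "0 < sqrt t" using t by simp
next
  assume "ess_inf (ball x (sqrt t)) f = - \<infinity>"
  \<comment> \<open>A positive kernel value times \<open>top\<close> is \<open>top\<close> at every
    point.\<close>
  then have "?N = (\<integral>\<^sup>+ (y :: real ^ 'n). top \<partial>lebesgue)"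
    using heat_kernel_pos[OF t, where 'n='n]
    by (intro nn_integral_cong) (simp add: ennreal_mult_top max_def ennreal_eq_0_iff not_le)
  also have "\<dots> = top" by simp
  finally have "?N = top" .
  then show ?thesis by simp
next
  fix m assume m: "ess_inf (ball x (sqrt t)) f = ereal m"
  let ?B = "ball x (sqrt t)"
  have [measurable]: "?B \<in> sets lebesgue" by simp
  let ?I = "LINT y:?B|lebesgue. f y - m" and ?a = "heat_peak TYPE('n) t * exp (- (1 / 4))"
  have a: "0 \<le> ?a" using heat_peak_pos[OF t, where 'n='n] by simp
  have [measurable]: "f \<in> borel_measurable lebesgue" by (rule L1_loc_measurable[OF f])
  have "ennreal (?a * ?I) = ennreal ?a * (\<integral>\<^sup>+ y. ennreal (f y - m) * indicator ?B y \<partial>lebesgue)"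
    using a set_integral_diff_ess_inf_nonneg[OF m] by (simp add: nn_integral_diff_ess_inf[OF f m] ennreal_mult)
  also have "\<dots> = (\<integral>\<^sup>+ y. ennreal ?a * (ennreal (f y - m) * indicator ?B y) \<partial>lebesgue)"
    by (rule nn_integral_cmult[symmetric]) measurable
  also have "\<dots> \<le> ?N"
  proof (rule nn_integral_mono)
    fix y
    show "ennreal ?a * (ennreal (f y - m) * indicator ?B y) \<le> ennreal (heat_kernel t (x - y)) *
        e2ennreal (max (ereal (f y) - ess_inf ?B f) 0)"
    proof (cases "y \<in> ?B")
      case True
      then have "ennreal ?a * ennreal (f y - m)
          \<le> ennreal (heat_kernel t (x - y)) * ennreal (max (f y - m) 0)"
        using heat_kernel_ge[OF t, of "x - y"]
        by (intro mult_mono ennreal_leI) (auto simp: dist_norm)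
      \<comment> \<open>Where \<open>f y \<le> m\<close>, both sides vanish because
        \<open>ennreal\<close> sends negative numbers to 0.\<close>
      then show ?thesis
        using True by (cases "f y \<le> m") (simp_all add: m max_def zero_ereal_def ennreal_neg)
    qed simp
  qed
  finally have "ereal (?a * ?I) \<le> enn2ereal ?N"
    using a set_integral_diff_ess_inf_nonneg[OF m] by (subst ereal_le_enn2ereal_iff) auto
  moreover have M: "0 < measure lebesgue ?B" using t by (intro measure_ball_pos) simp
  then have "heat_peak TYPE('n) 1 * measure lebesgue (ball (0 :: real ^ 'n) 1) * exp (- (1 / 4))
      * (?I / measure lebesgue ?B) = ?a * ?I"
    using heat_peak_measure_ball[OF t, of 1 x, symmetric]
    by (simp add: field_simps del: measure_completion)
  ultimately show ?thesis by (simp add: lower_osc_finite[OF m] del: measure_completion)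
qed

text \<open>The volume growth (k+1)^n is polynomial and loses against the Gaussian; the comparison
  with k^(-2) is asymptotic, so k = 0 is harmless.\<close>

lemma summable_shell_weights: "summable (\<lambda>k. (real k + 1) ^ n * exp (- (real k)\<^sup>2 / 4))"
proof (rule summable_comparison_test_bigo)
  show "summable (\<lambda>k. norm (inverse (real k ^ 2)))"
    using inverse_power_summable[of 2, where 'a=real] by simp
  show "(\<lambda>k. (real k + 1) ^ n * exp (- (real k)\<^sup>2 / 4)) \<in> O(\<lambda>k. inverse (real k ^ 2))"
    by real_asymp
qed

lemma heat_pos_term_upper:
  fixes f :: "real ^ 'n \<Rightarrow> real"
  assumes f: "f \<in> L1_loc" and t: "0 < t" and N: "BLO_norm f = ereal N"
  shows "(\<integral>\<^sup>+ y. ennreal (heat_kernel t (x - y)) *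
       e2ennreal (max (ereal (f y) - ess_inf (ball x (sqrt t)) f) 0) \<partial>lebesgue)
    \<le> ennreal (heat_peak TYPE('n) 1 * measure lebesgue (ball (0 :: real ^ 'n) 1)
       * (\<Sum>k. (real k + 1) ^ CARD('n) * exp (- (real k)\<^sup>2 / 4)) * N)"
    (is "?N \<le> ennreal (?c * suminf ?w * N)")
proof -
  let ?B = "\<lambda>k. ball x (sqrt t * (real k + 1))"
  let ?a = "\<lambda>k. heat_peak TYPE('n) t * exp (- (real k)\<^sup>2 / 4)"
  have N0: "0 \<le> N" using BLO_norm_nonneg[of f] N by simp
  have c0: "0 < ?c"
    using heat_peak_pos[of 1, where 'n='n] measure_ball_pos[of 1 "0 :: real ^ 'n"] by simp
  have a0: "0 \<le> ?a k" for k using heat_peak_pos[OF t, where 'n='n] by simp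
  have [measurable]: "f \<in> borel_measurable lebesgue" by (rule L1_loc_measurable[OF f])
  have [measurable]: "?B k \<in> sets lebesgue" for k by simp
  have r: "0 < sqrt t * (real k + 1)" for k using t by simp
  \<comment> \<open>The value \<open>-\<infinity>\<close> would make \<open>lower_osc\<close>
    infinite on this ball, against the finite norm.\<close>
  have "\<exists>m. ess_inf (?B k) f = ereal m" for k
  proof (rule ess_inf_ball_cases[OF r[of k], of x f])
    assume "ess_inf (?B k) f = - \<infinity>"
    then show ?thesis
      using lower_osc_le_BLO_norm[OF r[of k], of x f] N by (simp add: lower_osc_def)
  qed auto
  then obtain m where m: "\<And>k. ess_inf (?B k) f = ereal (m k)" by metis
  \<comment> \<open>The radius carries the factor k + 1, so index 0 is the original ball.\<close>
  have m0: "ess_inf (ball x (sqrt t)) f = ereal (m 0)" using m[of 0] by simp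
  have mono: "m k \<le> m 0" for k
  proof -
    have "?B 0 \<subseteq> ?B k" using t by (intro subset_ball mult_left_mono) auto
    then have "ess_inf (?B k) f \<le> ess_inf (?B 0) f" by (intro ess_inf_antimono) auto
    then show ?thesis by (simp only: m ereal_less_eq)
  qed
  have "?N \<le> (\<integral>\<^sup>+ y. (\<Sum>k. ennreal (?a k) * (ennreal (f y - m k) * indicator (?B k) y)) \<partial>lebesgue)"
  proof (rule nn_integral_mono)
    fix y
    \<comment> \<open>The index of the shell containing \<open>y\<close>. Its term alone dominates
      the integrand; the other terms of the series are nonnegative.\<close>
    define k where "k = nat \<lfloor>norm (x - y) / sqrt t\<rfloor>"
    have k: "real k \<le> norm (x - y) / sqrt t" "norm (x - y) / sqrt t < real k + 1"
      using t by (auto simp: k_def)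
    then have y: "y \<in> ?B k" "sqrt t * real k \<le> norm (x - y)"
      using t by (auto simp: field_simps dist_norm)
    have "ennreal (heat_kernel t (x - y)) * e2ennreal (max (ereal (f y) - ess_inf (ball x (sqrt t)) f) 0)
        = ennreal (heat_kernel t (x - y)) * ennreal (f y - m 0)"
      by (simp add: m0 max_def zero_ereal_def ennreal_neg)
    \<comment> \<open>Lowering the subtracted constant from \<open>m 0\<close> to \<open>m k\<close>
      only increases the positive part.\<close>
    also have "\<dots> \<le> ennreal (?a k) * ennreal (f y - m k)"
      using heat_kernel_le[OF t y(2)] mono[of k] by (intro mult_mono ennreal_leI) auto
    also have "\<dots> = (\<Sum>k\<in>{k}. ennreal (?a k) * (ennreal (f y - m k) * indicator (?B k) y))"
      using y by simp
    also have "\<dots> \<le> (\<Sum>k. ennreal (?a k) * (ennreal (f y - m k) * indicator (?B k) y))"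
      by (rule sum_le_suminf) auto
    finally show "ennreal (heat_kernel t (x - y))
        * e2ennreal (max (ereal (f y) - ess_inf (ball x (sqrt t)) f) 0)
        \<le> (\<Sum>k. ennreal (?a k) * (ennreal (f y - m k) * indicator (?B k) y))" .
  qed
  also have "\<dots> = (\<Sum>k. \<integral>\<^sup>+ y. ennreal (?a k) * (ennreal (f y - m k) * indicator (?B k) y) \<partial>lebesgue)"
    by (rule nn_integral_suminf) measurable
  also have "\<dots> = (\<Sum>k. ennreal (?a k * (LINT y:?B k|lebesgue. f y - m k)))"
  proof (rule suminf_cong)
    fix k
    have "(\<integral>\<^sup>+ y. ennreal (?a k) * (ennreal (f y - m k) * indicator (?B k) y) \<partial>lebesgue)
        = ennreal (?a k) * (\<integral>\<^sup>+ y. ennreal (f y - m k) * indicator (?B k) y \<partial>lebesgue)"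
      by (rule nn_integral_cmult) measurable
    then show "(\<integral>\<^sup>+ y. ennreal (?a k) * (ennreal (f y - m k) * indicator (?B k) y) \<partial>lebesgue)
        = ennreal (?a k * (LINT y:?B k|lebesgue. f y - m k))"
      using a0[of k] set_integral_diff_ess_inf_nonneg[OF m[of k]]
      by (simp add: nn_integral_diff_ess_inf[OF f m] ennreal_mult)
  qed
  also have "\<dots> \<le> (\<Sum>k. ennreal (?c * ?w k * N))"
  proof (intro suminf_le ennreal_leI summableI)
    fix k
    have M: "0 < measure lebesgue (?B k)" using r by (rule measure_ball_pos)
    have "(LINT y:?B k|lebesgue. f y - m k) / measure lebesgue (?B k) \<le> N"
      using lower_osc_le_BLO_norm[OF r[of k], of x f] by (simp add: N lower_osc_finite[OF m] del: measure_completion)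
    then have "(LINT y:?B k|lebesgue. f y - m k) \<le> measure lebesgue (?B k) * N"
      using M by (simp add: field_simps del: measure_completion)
    then have "?a k * (LINT y:?B k|lebesgue. f y - m k) \<le> ?a k * (measure lebesgue (?B k) * N)"
      using a0 by (rule mult_left_mono)
    also have "\<dots> = heat_peak TYPE('n) t * measure lebesgue (?B k) * exp (- (real k)\<^sup>2 / 4) * N"
      by (simp add: mult_ac del: measure_completion)
    also have "\<dots> = ?c * ?w k * N"
      by (subst heat_peak_measure_ball[OF t]) (simp_all add: mult_ac del: measure_completion)
    finally show "?a k * (LINT y:?B k|lebesgue. f y - m k) \<le> ?c * ?w k * N" .
  qed
  \<comment> \<open>Convergence of the real series enters here; in \<open>ennreal\<close> every
    series is summable.\<close>
  also have "\<dots> = ennreal (\<Sum>k. ?c * ?w k * N)"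
    using c0 N0 by (intro suminf_ennreal2 summable_mult summable_mult2 summable_shell_weights) auto
  also have "(\<Sum>k. ?c * ?w k * N) = ?c * suminf ?w * N"
    using suminf_mult2[OF summable_mult[OF summable_shell_weights], of ?c "CARD('n)" N]
      suminf_mult[OF summable_shell_weights, of ?c "CARD('n)"] by simp
  finally show ?thesis .
qed

lemma heat_pos_sup_lower:
  fixes f :: "real ^ 'n \<Rightarrow> real"
  assumes f: "f \<in> L1_loc"
  shows "ereal (heat_peak TYPE('n) 1 * measure lebesgue (ball (0 :: real ^ 'n) 1) * exp (- (1 / 4)))
    * BLO_norm f \<le> heat_pos_sup f"
proof (rule mult_BLO_norm_le)
  fix x :: "real ^ 'n" and r :: real assume r: "0 < r"
  then show "ereal (heat_peak TYPE('n) 1 * measure lebesgue (ball (0 :: real ^ 'n) 1) * exp (- (1 / 4)))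
      * lower_osc (ball x r) f \<le> heat_pos_sup f"
    unfolding heat_pos_sup_def
    using heat_pos_term_lower[OF f, of "r\<^sup>2" x]
    by (intro SUP_upper2[of "(x, r\<^sup>2)"]) auto
qed (use heat_peak_pos[of 1, where 'n='n] in simp)

text \<open>If the norm is infinite, strict positivity of \<open>C\<close> makes the right side
  infinite; otherwise the shell estimate applies at each point and time.\<close>

lemma heat_pos_sup_upper:
  fixes f :: "real ^ 'n \<Rightarrow> real"
  assumes f: "f \<in> L1_loc"
    and C: "heat_peak TYPE('n) 1 * measure lebesgue (ball (0 :: real ^ 'n) 1)
       * (\<Sum>k. (real k + 1) ^ CARD('n) * exp (- (real k)\<^sup>2 / 4)) \<le> C" "0 < C"
  shows "heat_pos_sup f \<le> ereal C * BLO_norm f"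
proof (cases "BLO_norm f")
  case (real N)
  then have N0: "0 \<le> N" using BLO_norm_nonneg[of f] by simp
  have "enn2ereal (\<integral>\<^sup>+ y. ennreal (heat_kernel t (x - y)) *
       e2ennreal (max (ereal (f y) - ess_inf (ball x (sqrt t)) f) 0) \<partial>lebesgue) \<le> ereal (C * N)"
    (is "enn2ereal ?N \<le> _") if "0 < t" for x :: "real ^ 'n" and t
  proof -
    have "?N \<le> ennreal (C * N)"
      using heat_pos_term_upper[OF f that real, of x] ennreal_leI[OF mult_right_mono[OF C(1) N0]]
      by (rule order_trans)
    then show ?thesis
      using C N0 by (subst enn2ereal_le_ereal_iff) auto
  qed
  then show ?thesis
    unfolding heat_pos_sup_def by (auto simp: real intro!: SUP_least)
qed (use C BLO_norm_nonneg[of f] in auto)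

section \<open>Equivalence of the three conditions\<close>

lemma ereal_finite_iff_comparable:
  fixes a h :: ereal
  assumes "0 < c" "0 \<le> a" "ereal c * a \<le> h" "h \<le> ereal C * a"
  shows "a < \<infinity> \<longleftrightarrow> h < \<infinity>"
  using assms by (cases a; cases h) (auto split: if_splits)

theorem theorem1p2:
  shows "(\<forall>f :: real ^ 'n \<Rightarrow> real. f \<in> L1_loc \<longrightarrow>
            (f \<in> BLO \<longleftrightarrow> heat_pos_sup f < \<infinity>) \<and>
            (f \<in> BLO \<longleftrightarrow> heat_local_sup f < \<infinity>)) \<and>
         (\<exists>c C :: real. 0 < c \<and> c \<le> C \<and>
            (\<forall>f :: real ^ 'n \<Rightarrow> real. f \<in> L1_loc \<longrightarrow>
               ereal c * BLO_norm f \<le> heat_pos_sup f \<and>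
               heat_pos_sup f \<le> ereal C * BLO_norm f)) \<and>
         (\<forall>f :: real ^ 'n \<Rightarrow> real. f \<in> L1_loc \<longrightarrow>
            ereal (exp (- (1 / 4))) * BLO_norm f \<le> heat_local_sup f \<and>
            heat_local_sup f \<le> ereal (exp (1 / 4)) * BLO_norm f)"
proof -
  define c0 where "c0 = heat_peak TYPE('n) 1 * measure lebesgue (ball (0 :: real ^ 'n) 1)"
  define c where "c = c0 * exp (- (1 / 4))"
  \<comment> \<open>The maximum makes \<open>c \<le> C\<close> and \<open>0 < C\<close>
    immediate.\<close>
  define C where "C = max c (c0 * (\<Sum>k. (real k + 1) ^ CARD('n) * exp (- (real k)\<^sup>2 / 4)))"
  have c: "0 < c"
    using heat_peak_pos[of 1, where 'n='n] measure_ball_pos[of 1 "0 :: real ^ 'n"]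
    by (simp add: c_def c0_def)
  have lower: "ereal c * BLO_norm f \<le> heat_pos_sup f" if "f \<in> L1_loc" for f :: "real ^ 'n \<Rightarrow> real"
    using heat_pos_sup_lower[OF that] by (simp add: c_def c0_def)
  have upper: "heat_pos_sup f \<le> ereal C * BLO_norm f" if "f \<in> L1_loc" for f :: "real ^ 'n \<Rightarrow> real"
  proof (rule heat_pos_sup_upper[OF that])
    show "heat_peak TYPE('n) 1 * measure lebesgue (ball (0 :: real ^ 'n) 1)
        * (\<Sum>k. (real k + 1) ^ CARD('n) * exp (- (real k)\<^sup>2 / 4)) \<le> C"
      by (simp add: C_def c0_def)
    show "0 < C" using c by (simp add: C_def)
  qed
  \<comment> \<open>The lower constants must be strictly positive: an infinite norm then forces an
    infinite functional, whereas 0 times infinity is 0 in \<open>ereal\<close>.\<close>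
  have "f \<in> BLO \<longleftrightarrow> heat_pos_sup f < \<infinity>" "f \<in> BLO \<longleftrightarrow> heat_local_sup f < \<infinity>"
    if f: "f \<in> L1_loc" for f :: "real ^ 'n \<Rightarrow> real"
    using ereal_finite_iff_comparable[OF c BLO_norm_nonneg lower[OF f] upper[OF f]] f
      ereal_finite_iff_comparable[OF exp_gt_zero BLO_norm_nonneg heat_local_sup_bounds[OF f]]
    by (auto simp: BLO_def)
  moreover have "c \<le> C" by (simp add: C_def)
  ultimately show ?thesis
    using c lower upper heat_local_sup_bounds by blast
qed

end
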